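(* For a simple mixed graph $G$ on $n$ vertices, $\boldsymbol{\nu}_{2n-1}(G)\leq\frac{4e(G)+2a(G)}{2n-1}\leq\boldsymbol{\nu}_{1}(G)$, where $\boldsymbol{\nu}_1(G)\ge\cdots\ge\boldsymbol{\nu}_{2n}(G)$ are the eigenvalues of the integrated Laplacian matrix of $G$.
   Context: A mixed graph has a finite vertex set $V_G$, a multiset $E_G$ of edges (unordered pairs) and a multiset $\vec{E}_G$ of arcs (ordered pairs); it is simple if it has no loops, no directed loops, no multiple edges and no multiple arcs. $e(G)$ is the number of edges and $a(G)$ the number of arcs. $d(v)$ is the number of edges at $v$; $d^+(v)$ (resp. $d^-(v)$) is the number of arcs starting (resp. ending) at $v$. For $V_G=\{v_1,\dots,v_n\}$, the integrated adjacency matrix $\mathcal{I}(G)$ is the $2n\times 2n$ symmetric matrix indexed by $v'_1,\dots,v'_n,v''_1,\dots,v''_n$ whose $(v'_i,v'_j)$ and $(v''_i,v''_j)$ entries are the number of edges joining $v_i,v_j$ and whose $(v'_i,v''_j)$ and $(v''_j,v'_i)$ entries are the number of arcs from $v_i$ to $v_j$. The integrated degree matrix $\mathcal{I}^D(G)$ is diagonal with $(v'_i,v'_i)$ entry $d(v_i)+d^+(v_i)$ and $(v''_i,v''_i)$ entry $d(v_i)+d^-(v_i)$; the integrated Laplacian matrix is $\mathcal{I}^L(G)=\mathcal{I}^D(G)-\mathcal{I}(G)$. *)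

theory Defs
  imports
    Complex_Main
    "HOL-Library.Multiset"
    "HOL-Library.Uprod"
    "Jordan_Normal_Form.Char_Poly"
begin

record 'a pre_mixed_graph =
  verts :: "'a set"
  edges :: "'a uprod multiset"
  arcs :: "('a \<times> 'a) multiset"

locale mixed_graph =
  fixes G :: "('a, 'b) pre_mixed_graph_scheme" (structure)
  assumes finite_verts: "finite (verts G)"
    and edges_in_verts: "\<And>e. e \<in># edges G \<Longrightarrow> set_uprod e \<subseteq> verts G"
    and arcs_in_verts: "\<And>u w. (u, w) \<in># arcs G \<Longrightarrow> u \<in> verts G \<and> w \<in> verts G"

text \<open>Multiplicity is counted separately for edges and for arcs, and the arcs
  \<open>(u, w)\<close> and \<open>(w, u)\<close> are different. So a simple mixed graph may have an edge
  and both arcs between the same two vertices.\<close>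

locale simple_mixed_graph = mixed_graph +
  assumes no_loops: "\<And>u. Upair u u \<notin># edges G"
    and no_directed_loops: "\<And>u. (u, u) \<notin># arcs G"
    and no_multiple_edges: "\<And>e. count (edges G) e \<le> 1"
    and no_multiple_arcs: "\<And>p. count (arcs G) p \<le> 1"

definition num_edges :: "('a, 'b) pre_mixed_graph_scheme \<Rightarrow> nat" where
  "num_edges G = size (edges G)"

definition num_arcs :: "('a, 'b) pre_mixed_graph_scheme \<Rightarrow> nat" where
  "num_arcs G = size (arcs G)"

text \<open>A loop contributes 1 to \<open>edge_degree\<close>.\<close>

definition edge_degree :: "('a, 'b) pre_mixed_graph_scheme \<Rightarrow> 'a \<Rightarrow> nat" where
  "edge_degree G u = size {#e \<in># edges G. u \<in> set_uprod e#}"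

definition out_degree :: "('a, 'b) pre_mixed_graph_scheme \<Rightarrow> 'a \<Rightarrow> nat" where
  "out_degree G u = size {#p \<in># arcs G. fst p = u#}"

definition in_degree :: "('a, 'b) pre_mixed_graph_scheme \<Rightarrow> 'a \<Rightarrow> nat" where
  "in_degree G u = size {#p \<in># arcs G. snd p = u#}"

text \<open>The matrices depend on an enumeration \<open>v 0, \<dots>, v (n - 1)\<close> of the vertices,
  where \<open>n = card (verts G)\<close>. Index \<open>i < n\<close> stands for the first copy \<open>v'\<close> and index
  \<open>n + i\<close> for the second copy \<open>v''\<close> of the vertex \<open>v i\<close>.\<close>

definition integrated_adjacency_matrix ::
    "('a, 'b) pre_mixed_graph_scheme \<Rightarrow> (nat \<Rightarrow> 'a) \<Rightarrow> real mat" where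
  "integrated_adjacency_matrix G v =
     (let n = card (verts G);
          A = mat n n (\<lambda>(i, j). real (count (edges G) (Upair (v i) (v j))));
          B = mat n n (\<lambda>(i, j). real (count (arcs G) (v i, v j)))
      in four_block_mat A B (transpose_mat B) A)"

definition integrated_degree_matrix ::
    "('a, 'b) pre_mixed_graph_scheme \<Rightarrow> (nat \<Rightarrow> 'a) \<Rightarrow> real mat" where
  "integrated_degree_matrix G v =
     (let n = card (verts G)
      in mat (2 * n) (2 * n) (\<lambda>(r, c).
           if r \<noteq> c then 0
           else if r < n then real (edge_degree G (v r) + out_degree G (v r))
           else real (edge_degree G (v (r - n)) + in_degree G (v (r - n)))))"

definition integrated_laplacian_matrix ::
    "('a, 'b) pre_mixed_graph_scheme \<Rightarrow> (nat \<Rightarrow> 'a) \<Rightarrow> real mat" where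
  "integrated_laplacian_matrix G v =
     integrated_degree_matrix G v - integrated_adjacency_matrix G v"

text \<open>The real eigenvalues with algebraic multiplicity, in decreasing order. For a
  symmetric matrix these are all the eigenvalues, so the list has length
  \<open>dim_row A\<close>.\<close>

definition eigenvalues_desc :: "real mat \<Rightarrow> real list" where
  "eigenvalues_desc A = rev (sorted_list_of_multiset (proots (char_poly A)))"

text \<open>The index \<open>k\<close> starts at 1.\<close>

definition laplacian_eigenvalue ::
    "('a, 'b) pre_mixed_graph_scheme \<Rightarrow> (nat \<Rightarrow> 'a) \<Rightarrow> nat \<Rightarrow> real" where
  "laplacian_eigenvalue G v k =
     eigenvalues_desc (integrated_laplacian_matrix G v) ! (k - 1)"

end

theory Submission
  imports Defs "Jordan_Normal_Form.Schur_Decomposition"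
begin

text \<open>The integrated Laplacian is symmetric, so its characteristic polynomial splits over the
  reals and its eigenvalues sum to the trace \<open>4 e(G) + 2 a(G)\<close>. Its rows sum to zero, so \<open>0\<close> is
  an eigenvalue, and its off-diagonal entries are nonpositive, so no eigenvalue is negative.
  Hence the last eigenvalue is \<open>0\<close>, and the bounds compare the extreme ones among the remaining
  \<open>2 n - 1\<close> with their average.\<close>

section \<open>Eigenvalues of symmetric matrices and of matrices with zero row sums\<close>

text \<open>Pairing the eigenvector equation with the conjugate of \<open>x\<close> gives the
  Hermitian form \<open>S\<close>. It is real because \<open>A\<close> is real and symmetric, and it
  equals \<open>e\<close> times the squared norm of \<open>x\<close>, which is a nonzero real
  number.\<close>

lemma symmetric_complex_root_real:
  fixes A :: "real mat"
  assumes A: "A \<in> carrier_mat m m"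
    and sym: "\<And>i j. i < m \<Longrightarrow> j < m \<Longrightarrow> A $$ (i, j) = A $$ (j, i)"
    and ev: "eigenvalue (map_mat complex_of_real A) e"
  shows "e \<in> \<real>"
proof -
  obtain x where x: "x \<in> carrier_vec m" "x \<noteq> 0\<^sub>v m"
    and eq: "map_mat complex_of_real A *\<^sub>v x = e \<cdot>\<^sub>v x"
    using ev A unfolding eigenvalue_def eigenvector_def by auto
  have row: "(\<Sum>j<m. complex_of_real (A $$ (i, j)) * x $ j) = e * x $ i" if "i < m" for i
  proof -
    have "(map_mat complex_of_real A *\<^sub>v x) $ i = (e \<cdot>\<^sub>v x) $ i"
      using eq by simp
    then show ?thesis
      using that A x by (auto simp: scalar_prod_def lessThan_atLeast0)
  qed
  define S where "S = (\<Sum>i<m. cnj (x $ i) * (\<Sum>j<m. complex_of_real (A $$ (i, j)) * x $ j))"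
  \<comment> \<open>Conjugation fixes the entries of \<open>A\<close>. Exchanging the summation
    indices and using symmetry then returns \<open>S\<close> itself.\<close>
  have "cnj S = (\<Sum>i<m. \<Sum>j<m. x $ i * complex_of_real (A $$ (i, j)) * cnj (x $ j))"
    by (simp add: S_def sum_distrib_left mult.assoc)
  also have "\<dots> = (\<Sum>j<m. \<Sum>i<m. x $ i * complex_of_real (A $$ (i, j)) * cnj (x $ j))"
    by (rule sum.swap)
  also have "\<dots> = S"
    unfolding S_def sum_distrib_left
    by (intro sum.cong refl) (simp add: sym mult_ac)
  finally have "S \<in> \<real>"
    by (simp add: Reals_cnj_iff)
  moreover have S_eq: "S = e * complex_of_real (\<Sum>i<m. (cmod (x $ i))\<^sup>2)"
  proof -
    have "S = (\<Sum>i<m. e * complex_of_real ((cmod (x $ i))\<^sup>2))"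
      unfolding S_def
    proof (intro sum.cong refl)
      fix i assume "i \<in> {..<m}"
      then have "cnj (x $ i) * (\<Sum>j<m. complex_of_real (A $$ (i, j)) * x $ j)
          = cnj (x $ i) * (e * x $ i)"
        by (simp only: row lessThan_iff)
      also have "\<dots> = e * complex_of_real ((cmod (x $ i))\<^sup>2)"
        by (simp only: complex_norm_square mult_ac)
      finally show "cnj (x $ i) * (\<Sum>j<m. complex_of_real (A $$ (i, j)) * x $ j)
          = e * complex_of_real ((cmod (x $ i))\<^sup>2)" .
    qed
    then show ?thesis by (simp only: of_real_sum sum_distrib_left)
  qed
  moreover have "(\<Sum>i<m. (cmod (x $ i))\<^sup>2) \<noteq> 0"
  proof
    assume "(\<Sum>i<m. (cmod (x $ i))\<^sup>2) = 0"
    then have "\<forall>i\<in>{..<m}. (cmod (x $ i))\<^sup>2 = 0"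
      using sum_nonneg_eq_0_iff[of "{..<m}" "\<lambda>i. (cmod (x $ i))\<^sup>2"] by simp
    with x(1) have "x = 0\<^sub>v m" by (intro eq_vecI) auto
    with x(2) show False ..
  qed
  then have "e = S / complex_of_real (\<Sum>i<m. (cmod (x $ i))\<^sup>2)"
    unfolding S_eq by (metis nonzero_mult_div_cancel_right of_real_eq_0_iff)
  ultimately show ?thesis
    by (metis Reals_divide Reals_of_real)
qed

text \<open>Over the complex numbers the characteristic polynomial factors completely. All its roots
  are real, so the factorization descends along the injective embedding of real into complex
  polynomials.\<close>

lemma symmetric_char_poly_splits:
  fixes A :: "real mat"
  assumes A: "A \<in> carrier_mat m m"
    and sym: "\<And>i j. i < m \<Longrightarrow> j < m \<Longrightarrow> A $$ (i, j) = A $$ (j, i)"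
  obtains es where "char_poly A = (\<Prod>e\<leftarrow>es. [:- e, 1:])" "length es = m"
proof -
  interpret of_real_poly_hom: map_poly_inj_idom_hom complex_of_real ..
  let ?C = "map_mat complex_of_real A"
  have C: "?C \<in> carrier_mat m m" using A by simp
  obtain cs where cs: "char_poly ?C = (\<Prod>c\<leftarrow>cs. [:- c, 1:])" "length cs = m"
    using char_poly_factorized[OF C] by auto
  have real: "c \<in> \<real>" if "c \<in> set cs" for c
  proof (rule symmetric_complex_root_real[OF A sym])
    have "poly (char_poly ?C) c = 0"
      unfolding cs poly_prod_list using that by (auto simp: prod_list_zero_iff image_iff)
    then show "eigenvalue ?C c"
      by (simp add: eigenvalue_root_char_poly[OF C])
  qed
  have "map_poly complex_of_real (char_poly A) = char_poly ?C"
    using of_real_hom.char_poly_hom[OF A] by metis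
  \<comment> \<open>Taking real parts loses nothing, since every root in \<open>cs\<close> is
    real.\<close>
  also have "\<dots> = (\<Prod>c\<leftarrow>map Re cs. [:- complex_of_real c, 1:])"
    unfolding cs(1) map_map o_def by (intro arg_cong[of _ _ prod_list] map_cong) (auto simp: real)
  also have "\<dots> = map_poly complex_of_real (\<Prod>c\<leftarrow>map Re cs. [:- c, 1:])"
    by (simp add: of_real_poly_hom.hom_prod_list o_def)
  finally have "char_poly A = (\<Prod>c\<leftarrow>map Re cs. [:- c, 1:])"
    by simp
  with cs(2) show ?thesis
    by (intro that[of "map Re cs"]) auto
qed

lemma sum_diag_mult_commute:
  fixes X Y :: "'a :: comm_semiring_0 mat"
  assumes "X \<in> carrier_mat m k" "Y \<in> carrier_mat k m"
  shows "(\<Sum>i<m. (X * Y) $$ (i, i)) = (\<Sum>i<k. (Y * X) $$ (i, i))"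
proof -
  have "(\<Sum>i<m. (X * Y) $$ (i, i)) = (\<Sum>i<m. \<Sum>j<k. X $$ (i, j) * Y $$ (j, i))"
    using assms by (intro sum.cong) (auto simp: scalar_prod_def lessThan_atLeast0)
  also have "\<dots> = (\<Sum>j<k. \<Sum>i<m. Y $$ (j, i) * X $$ (i, j))"
    by (subst sum.swap) (simp add: mult.commute)
  also have "\<dots> = (\<Sum>i<k. (Y * X) $$ (i, i))"
    using assms by (intro sum.cong) (auto simp: scalar_prod_def lessThan_atLeast0)
  finally show ?thesis .
qed

text \<open>Schur decomposition writes \<open>A = P * B * Q\<close> with \<open>Q * P\<close> the
  identity and \<open>es\<close> on the diagonal of \<open>B\<close>. Cyclicity of the trace moves
  \<open>P\<close> to the right end, where it cancels against \<open>Q\<close>.\<close>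

lemma sum_list_eigenvalues_eq_trace:
  fixes A :: "'a :: conjugatable_ordered_field mat"
  assumes A: "A \<in> carrier_mat m m" and es: "char_poly A = (\<Prod>e\<leftarrow>es. [:- e, 1:])"
  shows "sum_list es = (\<Sum>i<m. A $$ (i, i))"
proof -
  obtain B P Q where "schur_decomposition A es = (B, P, Q)"
    by (cases "schur_decomposition A es") auto
  from schur_decomposition[OF A es this]
  have sim: "similar_mat_wit A B P Q" and diag: "diag_mat B = es" by auto
  note w = similar_mat_witD2[OF A sim]
  have "A = P * (B * Q)"
    using w(3) assoc_mult_mat[OF w(6,5,7)] by simp
  then have "(\<Sum>i<m. A $$ (i, i)) = (\<Sum>i<m. (P * (B * Q)) $$ (i, i))"
    by (rule arg_cong)
  also have "\<dots> = (\<Sum>i<m. (B * Q * P) $$ (i, i))"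
    using w(5-7) by (intro sum_diag_mult_commute) auto
  also have "B * Q * P = B"
    using assoc_mult_mat[OF w(5,7,6)] w(2) right_mult_one_mat[OF w(5)] by simp
  also have "(\<Sum>i<m. B $$ (i, i)) = sum_list (map (\<lambda>i. B $$ (i, i)) [0..<m])"
    by (simp add: interv_sum_list_conv_sum_set_nat lessThan_atLeast0)
  also have "map (\<lambda>i. B $$ (i, i)) [0..<m] = es"
    using diag w(5) by (simp add: diag_mat_def)
  finally show ?thesis by simp
qed

text \<open>Gershgorin: compare the eigenvector equation at a coordinate of maximal absolute value.\<close>

lemma eigenvalue_nonneg_of_zero_row_sums:
  fixes A :: "real mat"
  assumes A: "A \<in> carrier_mat m m"
    and rows: "\<And>i. i < m \<Longrightarrow> (\<Sum>j<m. A $$ (i, j)) = 0"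
    and offdiag: "\<And>i j. i < m \<Longrightarrow> j < m \<Longrightarrow> i \<noteq> j \<Longrightarrow> A $$ (i, j) \<le> 0"
    and ev: "eigenvalue A k"
  shows "0 \<le> k"
proof -
  obtain x where x: "x \<in> carrier_vec m" "x \<noteq> 0\<^sub>v m" and eq: "A *\<^sub>v x = k \<cdot>\<^sub>v x"
    using ev A unfolding eigenvalue_def eigenvector_def by auto
  have "\<exists>i<m. x $ i \<noteq> 0"
  proof (rule ccontr)
    assume "\<not> (\<exists>i<m. x $ i \<noteq> 0)"
    with x(1) have "x = 0\<^sub>v m" by (intro eq_vecI) auto
    with x(2) show False ..
  qed
  then obtain i0 where i0: "i0 < m" "x $ i0 \<noteq> 0" by blast
  define M where "M = Max ((\<lambda>i. \<bar>x $ i\<bar>) ` {..<m})"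
  have "M \<in> (\<lambda>i. \<bar>x $ i\<bar>) ` {..<m}"
    unfolding M_def using i0 by (intro Max_in) auto
  then obtain i where i: "i < m" "\<bar>x $ i\<bar> = M" by auto
  have le: "\<bar>x $ j\<bar> \<le> M" if "j < m" for j
    unfolding M_def using that by (intro Max_ge) auto
  \<comment> \<open>Positivity makes \<open>x $ i\<close> nonzero, so that its square can be
    cancelled at the end.\<close>
  have Mpos: "M > 0" using le[OF i0(1)] i0(2) by linarith
  have "(A *\<^sub>v x) $ i = (k \<cdot>\<^sub>v x) $ i" using eq by simp
  then have "k * x $ i = (\<Sum>j<m. A $$ (i, j) * x $ j)"
    using i A x by (auto simp: scalar_prod_def lessThan_atLeast0)
  \<comment> \<open>The extra factor \<open>x $ i\<close> avoids a case distinction on its sign: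
    each \<open>x $ j * x $ i\<close> is at most \<open>x $ i * x $ i\<close>, and the nonpositive
    off-diagonal entries reverse this inequality.\<close>
  then have "k * (x $ i * x $ i) = (\<Sum>j<m. A $$ (i, j) * (x $ j * x $ i))"
    by (simp add: sum_distrib_right mult.assoc[symmetric])
  also have "\<dots> \<ge> (\<Sum>j<m. A $$ (i, j) * (x $ i * x $ i))"
  proof (intro sum_mono)
    fix j assume "j \<in> {..<m}"
    then have j: "j < m" by simp
    show "A $$ (i, j) * (x $ i * x $ i) \<le> A $$ (i, j) * (x $ j * x $ i)"
    proof (cases "j = i")
      case False
      have "x $ j * x $ i \<le> \<bar>x $ j\<bar> * \<bar>x $ i\<bar>"
        by (metis abs_ge_self abs_mult)
      also have "\<dots> \<le> \<bar>x $ i\<bar> * \<bar>x $ i\<bar>"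
        using le[OF j] i by (intro mult_right_mono) auto
      finally show ?thesis
        using offdiag[OF i(1) j] False by (intro mult_left_mono_neg) auto
    qed simp
  qed
  also have "(\<Sum>j<m. A $$ (i, j) * (x $ i * x $ i)) = 0"
    by (simp only: sum_distrib_right[symmetric] rows[OF i(1)] mult_zero_left)
  finally have "0 \<le> k * (x $ i * x $ i)" .
  moreover have "x $ i * x $ i > 0"
    using i Mpos by (auto simp: zero_less_mult_iff)
  ultimately show ?thesis
    by (simp add: zero_le_mult_iff)
qed

text \<open>The all-ones vector lies in the kernel; it is nonzero because
  \<open>m > 0\<close>.\<close>

lemma eigenvalue_zero_of_zero_row_sums:
  fixes A :: "'a :: comm_ring_1 mat"
  assumes A: "A \<in> carrier_mat m m" and "m > 0"
    and rows: "\<And>i. i < m \<Longrightarrow> (\<Sum>j<m. A $$ (i, j)) = 0"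
  shows "eigenvalue A 0"
proof -
  have "vec m (\<lambda>_. 1 :: 'a) $ 0 \<noteq> 0\<^sub>v m $ 0" using \<open>m > 0\<close> by simp
  then have "vec m (\<lambda>_. 1 :: 'a) \<noteq> 0\<^sub>v m" by metis
  moreover have "A *\<^sub>v vec m (\<lambda>_. 1) = 0 \<cdot>\<^sub>v vec m (\<lambda>_. 1)"
    using A rows by (intro eq_vecI) (auto simp: scalar_prod_def lessThan_atLeast0)
  ultimately show ?thesis
    using A unfolding eigenvalue_def eigenvector_def by (intro exI[of _ "vec m (\<lambda>_. 1)"]) auto
qed

section \<open>The ordered eigenvalues and their average\<close>

text \<open>This links a factorization of the characteristic polynomial to
  \<open>eigenvalues_desc\<close>, which is defined through \<open>proots\<close>.\<close>

lemma proots_prod_linear: "proots (\<Prod>e\<leftarrow>es. [:- e, 1:]) = mset es"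
  for es :: "'a :: idom list"
proof (induction es)
  case (Cons a es)
  have "(\<Prod>e\<leftarrow>es. [:- e, 1:]) \<noteq> 0"
    by (auto simp: prod_list_zero_iff)
  with Cons show ?case
    by (simp add: proots_mult del: mult_pCons_left)
qed simp

text \<open>The final zero adds nothing to the sum, so the quotient is the average of the first
  \<open>Suc k\<close> entries. These all lie between \<open>xs ! k\<close> and
  \<open>xs ! 0\<close>.\<close>

lemma sorted_desc_average_bounds:
  fixes xs :: "real list"
  assumes sorted: "sorted (rev xs)" and len: "length xs = Suc (Suc k)" and last: "xs ! Suc k = 0"
  shows "xs ! k \<le> sum_list xs / Suc k" "sum_list xs / Suc k \<le> xs ! 0"
proof -
  have mono: "xs ! j \<le> xs ! i" if "i \<le> j" "j < length xs" for i j
    using sorted that by (simp add: sorted_rev_nth_mono)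
  have sum: "sum_list xs = (\<Sum>i<Suc k. xs ! i)"
    by (simp add: sum_list_sum_nth len last lessThan_atLeast0[symmetric])
  have "(\<Sum>i<Suc k. xs ! k) \<le> (\<Sum>i<Suc k. xs ! i)"
    by (intro sum_mono mono) (auto simp: len)
  then show "xs ! k \<le> sum_list xs / Suc k"
    by (simp add: sum field_simps)
  have "(\<Sum>i<Suc k. xs ! i) \<le> (\<Sum>i<Suc k. xs ! 0)"
    by (intro sum_mono mono) (auto simp: len)
  then show "sum_list xs / Suc k \<le> xs ! 0"
    by (simp add: sum field_simps)
qed

lemma eigenvalues_desc_bounds:
  fixes A :: "real mat"
  assumes A: "A \<in> carrier_mat (Suc (Suc k)) (Suc (Suc k))"
    and sym: "\<And>i j. i < Suc (Suc k) \<Longrightarrow> j < Suc (Suc k) \<Longrightarrow> A $$ (i, j) = A $$ (j, i)"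
    and rows: "\<And>i. i < Suc (Suc k) \<Longrightarrow> (\<Sum>j<Suc (Suc k). A $$ (i, j)) = 0"
    and offdiag: "\<And>i j. i < Suc (Suc k) \<Longrightarrow> j < Suc (Suc k) \<Longrightarrow> i \<noteq> j \<Longrightarrow> A $$ (i, j) \<le> 0"
  shows "eigenvalues_desc A ! k \<le> (\<Sum>i<Suc (Suc k). A $$ (i, i)) / Suc k"
    and "(\<Sum>i<Suc (Suc k). A $$ (i, i)) / Suc k \<le> eigenvalues_desc A ! 0"
proof -
  obtain es where es: "char_poly A = (\<Prod>e\<leftarrow>es. [:- e, 1:])" "length es = Suc (Suc k)"
    using symmetric_char_poly_splits[OF A sym] by blast
  define xs where "xs = eigenvalues_desc A"
  have mset: "mset xs = mset es"
    by (simp add: xs_def eigenvalues_desc_def es(1) proots_prod_linear)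
  then have len: "length xs = Suc (Suc k)" and set: "set xs = set es"
    and sum: "sum_list xs = sum_list es"
    using es(2) by (metis mset_eq_length, metis mset_eq_setD, metis sum_mset_sum_list)
  have sorted: "sorted (rev xs)"
    by (simp add: xs_def eigenvalues_desc_def)
  have ev: "e \<in> set xs \<longleftrightarrow> eigenvalue A e" for e
    unfolding eigenvalue_root_char_poly[OF A] es(1) set poly_prod_list
    by (auto simp: prod_list_zero_iff image_iff)
  \<comment> \<open>The value 0 occurs somewhere in the decreasing list, so the last entry is at
    most 0. As an eigenvalue it is also nonnegative, hence equal to 0.\<close>
  have "0 \<in> set xs"
    using eigenvalue_zero_of_zero_row_sums[OF A _ rows] by (simp add: ev)
  then obtain i where "i < length xs" "xs ! i = 0" by (auto simp: in_set_conv_nth)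
  with sorted len have "xs ! Suc k \<le> 0"
    using sorted_rev_nth_mono[of xs i "Suc k"] by simp
  moreover have "eigenvalue A (xs ! Suc k)"
    using len by (simp add: ev[symmetric])
  then have "0 \<le> xs ! Suc k"
    using eigenvalue_nonneg_of_zero_row_sums[OF A rows offdiag] by blast
  ultimately have "xs ! Suc k = 0" by simp
  note bounds = sorted_desc_average_bounds[OF sorted len this, unfolded sum sum_list_eigenvalues_eq_trace[OF A es(1)]]
  show "eigenvalues_desc A ! k \<le> (\<Sum>i<Suc (Suc k). A $$ (i, i)) / Suc k"
    and "(\<Sum>i<Suc (Suc k). A $$ (i, i)) / Suc k \<le> eigenvalues_desc A ! 0"
    using bounds by (simp_all only: xs_def)
qed

section \<open>Degrees as sums of multiplicities, and double counting\<close>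

lemma size_eq_sum_count:
  assumes "finite S" "set_mset M \<subseteq> S"
  shows "size M = sum (count M) S"
  unfolding size_multiset_overloaded_eq
  using assms by (intro sum.mono_neutral_left) (auto simp: not_in_iff)

text \<open>Double counting of the incidences between \<open>V\<close> and \<open>M\<close>: an
  added element \<open>x\<close> contributes 1 for every \<open>u\<close> in \<open>V\<close> with
  \<open>P u x\<close>.\<close>

lemma sum_size_filter_mset:
  assumes "finite V"
  shows "(\<Sum>u\<in>V. size {#x \<in># M. P u x#}) = (\<Sum>x\<in>#M. card {u \<in> V. P u x})"
proof (induction M)
  case (add x M)
  have "(\<Sum>u\<in>V. size {#y \<in># add_mset x M. P u y#})
      = (\<Sum>u\<in>V. (if P u x then 1 else 0) + size {#y \<in># M. P u y#})"
    by (intro sum.cong) auto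
  then show ?case
    using assms add.IH by (simp add: sum.distrib sum.If_cases Int_def)
qed simp

context mixed_graph
begin

text \<open>An edge at \<open>u\<close> has the form \<open>Upair u w\<close> for exactly one vertex
  \<open>w\<close>. A loop is the case \<open>w = u\<close> and is counted once on both
  sides.\<close>

lemma edge_degree_eq_sum:
  assumes "u \<in> verts G"
  shows "edge_degree G u = (\<Sum>w\<in>verts G. count (edges G) (Upair u w))"
proof -
  have "edge_degree G u
      = sum (count {#e \<in># edges G. u \<in> set_uprod e#}) (Upair u ` verts G)"
    unfolding edge_degree_def
  proof (rule size_eq_sum_count)
    show "set_mset {#e \<in># edges G. u \<in> set_uprod e#} \<subseteq> Upair u ` verts G"
    proof
      fix e assume e: "e \<in># {#e \<in># edges G. u \<in> set_uprod e#}"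
      obtain a b where ab: "e = Upair a b" by (cases e)
      with e edges_in_verts[of e] show "e \<in> Upair u ` verts G"
        by (auto simp: image_iff)
    qed
  qed (simp add: finite_verts)
  also have "\<dots> = (\<Sum>w\<in>verts G. count {#e \<in># edges G. u \<in> set_uprod e#} (Upair u w))"
    by (subst sum.reindex) (auto simp: inj_on_def)
  finally show ?thesis by simp
qed

lemma out_degree_eq_sum: "out_degree G u = (\<Sum>w\<in>verts G. count (arcs G) (u, w))"
proof -
  have "out_degree G u = sum (count {#p \<in># arcs G. fst p = u#}) (Pair u ` verts G)"
    unfolding out_degree_def using arcs_in_verts finite_verts
    by (intro size_eq_sum_count) auto
  also have "\<dots> = (\<Sum>w\<in>verts G. count {#p \<in># arcs G. fst p = u#} (u, w))"
    by (subst sum.reindex) (auto simp: inj_on_def)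
  finally show ?thesis by simp
qed

lemma in_degree_eq_sum: "in_degree G u = (\<Sum>w\<in>verts G. count (arcs G) (w, u))"
proof -
  have "in_degree G u = sum (count {#p \<in># arcs G. snd p = u#}) ((\<lambda>w. (w, u)) ` verts G)"
    unfolding in_degree_def using arcs_in_verts finite_verts
    by (intro size_eq_sum_count) auto
  also have "\<dots> = (\<Sum>w\<in>verts G. count {#p \<in># arcs G. snd p = u#} (w, u))"
    by (subst sum.reindex) (auto simp: inj_on_def)
  finally show ?thesis by simp
qed

lemma sum_out_degree: "(\<Sum>u\<in>verts G. out_degree G u) = num_arcs G"
proof -
  have "card {u \<in> verts G. fst p = u} = 1" if "p \<in># arcs G" for p
  proof -
    have "{u \<in> verts G. fst p = u} = {fst p}"
      using that arcs_in_verts[of "fst p" "snd p"] by auto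
    then show ?thesis by simp
  qed
  then show ?thesis
    unfolding out_degree_def num_arcs_def sum_size_filter_mset[OF finite_verts]
    by (simp cong: image_mset_cong)
qed

lemma sum_in_degree: "(\<Sum>u\<in>verts G. in_degree G u) = num_arcs G"
proof -
  have "card {u \<in> verts G. snd p = u} = 1" if "p \<in># arcs G" for p
  proof -
    have "{u \<in> verts G. snd p = u} = {snd p}"
      using that arcs_in_verts[of "fst p" "snd p"] by auto
    then show ?thesis by simp
  qed
  then show ?thesis
    unfolding in_degree_def num_arcs_def sum_size_filter_mset[OF finite_verts]
    by (simp cong: image_mset_cong)
qed

end

text \<open>Handshake lemma. Without loops every edge has two distinct ends; a loop would contribute
  only 1 to \<open>edge_degree\<close>.\<close>

lemma (in simple_mixed_graph) sum_edge_degree: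
  "(\<Sum>u\<in>verts G. edge_degree G u) = 2 * num_edges G"
proof -
  have "card {u \<in> verts G. u \<in> set_uprod e} = 2" if "e \<in># edges G" for e
  proof -
    obtain a b where ab: "e = Upair a b" by (cases e)
    have "a \<noteq> b" using no_loops[of a] that ab by auto
    moreover have "{u \<in> verts G. u \<in> set_uprod e} = {a, b}"
      using edges_in_verts[OF that] ab by auto
    ultimately show ?thesis by simp
  qed
  then show ?thesis
    unfolding edge_degree_def num_edges_def sum_size_filter_mset[OF finite_verts]
    by (simp cong: image_mset_cong)
qed

section \<open>The integrated Laplacian matrix\<close>

text \<open>Used to split sums over matrix indices into the two copies of the vertex set.\<close>

lemma sum_lessThan_double: "(\<Sum>i<2 * n. f i) = (\<Sum>i<n. f i) + (\<Sum>i<n. f (n + i))"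
  for f :: "nat \<Rightarrow> 'a :: comm_monoid_add"
  using sum.atLeastLessThan_concat[of 0 n "2 * n" f]
    sum.shift_bounds_nat_ivl[of f 0 n n]
  by (simp add: lessThan_atLeast0 mult_2 add.commute)

theorem theorem3p8:
  fixes G :: "'a pre_mixed_graph" and v :: "nat \<Rightarrow> 'a" and n :: nat
  assumes "simple_mixed_graph G"
    and "card (verts G) = n" and "n \<ge> 1"
    and "bij_betw v {..<n} (verts G)"
  shows "laplacian_eigenvalue G v (2 * n - 1)
           \<le> (4 * real (num_edges G) + 2 * real (num_arcs G)) / (2 * real n - 1)
       \<and> (4 * real (num_edges G) + 2 * real (num_arcs G)) / (2 * real n - 1)
           \<le> laplacian_eigenvalue G v 1"
proof -
  interpret simple_mixed_graph G by fact
  define L where "L = integrated_laplacian_matrix G v"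
  define E where "E i j = real (count (edges G) (Upair (v i) (v j)))" for i j
  define R where "R i j = real (count (arcs G) (v i, v j))" for i j
  have L: "L \<in> carrier_mat (2 * n) (2 * n)"
    unfolding L_def integrated_laplacian_matrix_def integrated_degree_matrix_def
      integrated_adjacency_matrix_def
    by (auto simp: assms(2) Let_def)
  \<comment> \<open>The arguments of \<open>R\<close> are exchanged in the lower left block because
    that block is the transpose of the arc matrix.\<close>
  have adj: "integrated_adjacency_matrix G v $$ (i, j) =
      (if i < n then if j < n then E i j else R i (j - n)
       else if j < n then R j (i - n) else E (i - n) (j - n))"
    if "i < 2 * n" "j < 2 * n" for i j
    using that unfolding integrated_adjacency_matrix_def E_def R_def by (auto simp: assms(2) Let_def)
  have entry: "L $$ (i, j) = integrated_degree_matrix G v $$ (i, j)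
      - integrated_adjacency_matrix G v $$ (i, j)"
    if "i < 2 * n" "j < 2 * n" for i j
    using that unfolding L_def integrated_laplacian_matrix_def integrated_adjacency_matrix_def
    by (auto simp: assms(2) Let_def)
  have deg: "integrated_degree_matrix G v $$ (i, j) =
      (if i \<noteq> j then 0
       else if i < n then real (edge_degree G (v i) + out_degree G (v i))
       else real (edge_degree G (v (i - n)) + in_degree G (v (i - n))))"
    if "i < 2 * n" "j < 2 * n" for i j
    using that unfolding integrated_degree_matrix_def by (auto simp: assms(2) Let_def)
  have E_sym: "E i j = E j i" for i j
  proof -
    have "Upair (v i) (v j) = Upair (v j) (v i)" by simp
    then show ?thesis by (simp only: E_def)
  qed
  have sum_v: "(\<Sum>i<n. f (v i)) = sum f (verts G)" for f :: "'a \<Rightarrow> real"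
    by (rule sum.reindex_bij_betw[OF assms(4)])
  have v_in: "v i \<in> verts G" if "i < n" for i
    using assms(4) that by (auto dest: bij_betwE)
  have sum_E: "(\<Sum>j<n. E i j) = edge_degree G (v i)" if "i < n" for i
    unfolding E_def using sum_v[of "\<lambda>w. real (count (edges G) (Upair (v i) w))"]
    by (simp add: edge_degree_eq_sum[OF v_in[OF that]])
  have sum_R: "(\<Sum>j<n. R i j) = out_degree G (v i)" for i
    unfolding R_def using sum_v[of "\<lambda>w. real (count (arcs G) (v i, w))"]
    by (simp add: out_degree_eq_sum)
  have sum_R': "(\<Sum>j<n. R j i) = in_degree G (v i)" for i
    unfolding R_def using sum_v[of "\<lambda>w. real (count (arcs G) (w, v i))"]
    by (simp add: in_degree_eq_sum)
  have sym: "L $$ (i, j) = L $$ (j, i)" if "i < 2 * n" "j < 2 * n" for i j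
    using that by (auto simp: entry adj deg E_sym)
  have offdiag: "L $$ (i, j) \<le> 0" if "i < 2 * n" "j < 2 * n" "i \<noteq> j" for i j
    using that by (auto simp: entry adj deg E_def R_def)
  \<comment> \<open>A row of the adjacency matrix sums to edge degree plus out-degree in the first
    copy and to edge degree plus in-degree in the second. This is the diagonal entry of the degree
    matrix.\<close>
  have rows: "(\<Sum>j<2 * n. L $$ (i, j)) = 0" if i: "i < 2 * n" for i
  proof -
    have "(\<Sum>j<2 * n. integrated_degree_matrix G v $$ (i, j))
        = (\<Sum>j<2 * n. if j = i then integrated_degree_matrix G v $$ (i, i) else 0)"
      using i by (intro sum.cong) (auto simp: deg)
    also have "\<dots> = integrated_degree_matrix G v $$ (i, i)" using i by simp
    also have "\<dots> = (\<Sum>j<2 * n. integrated_adjacency_matrix G v $$ (i, j))"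
      unfolding sum_lessThan_double using i
      by (cases "i < n") (simp_all add: adj deg sum_E sum_R sum_R')
    finally show ?thesis
      using i by (simp add: entry sum_subtractf)
  qed
  have diag0: "E i i = 0" "R i i = 0" for i
    using no_loops no_directed_loops by (auto simp: E_def R_def not_in_iff)
  \<comment> \<open>Absence of loops makes the diagonal of the adjacency matrix vanish. Each vertex
    then contributes its edge degree twice and its out-degree and in-degree once each.\<close>
  have trace: "(\<Sum>i<2 * n. L $$ (i, i)) = 4 * real (num_edges G) + 2 * real (num_arcs G)"
  proof -
    have "(\<Sum>i<2 * n. L $$ (i, i)) = (\<Sum>i<n. real (edge_degree G (v i) + out_degree G (v i)))
        + (\<Sum>i<n. real (edge_degree G (v i) + in_degree G (v i)))"
      unfolding sum_lessThan_double by (simp add: entry adj deg diag0)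
    also have "\<dots> = real (2 * (\<Sum>u\<in>verts G. edge_degree G u)
        + (\<Sum>u\<in>verts G. out_degree G u) + (\<Sum>u\<in>verts G. in_degree G u))"
      using sum_v[of "\<lambda>u. real (edge_degree G u)"] sum_v[of "\<lambda>u. real (out_degree G u)"]
        sum_v[of "\<lambda>u. real (in_degree G u)"]
      by (simp add: sum.distrib)
    finally show ?thesis
      by (simp add: sum_edge_degree sum_out_degree sum_in_degree)
  qed
  \<comment> \<open>The eigenvalue with index \<open>2 * n - 1\<close>, counted from 1, stands at
    list position \<open>k\<close>. Since \<open>n \<ge> 1\<close>, the truncated subtractions are
    exact.\<close>
  define k where "k = 2 * n - 2"
  have k: "2 * n = Suc (Suc k)" "2 * n - 1 - 1 = k" "real (Suc k) = 2 * real n - 1"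
    using assms(3) by (auto simp: k_def)
  show ?thesis
    using eigenvalues_desc_bounds[OF L[unfolded k(1)] sym[unfolded k(1)] rows[unfolded k(1)]
        offdiag[unfolded k(1)]]
    unfolding trace[unfolded k(1)] laplacian_eigenvalue_def L_def[symmetric] k(2) k(3)
    by simp
qed

end
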